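(* Let $n,m\ge 1$ be integers and let $A=(a_{ij})$ be an $n\times m$ matrix with entries in $\mathbb{R}$. Let $1/4<\alpha<1$, $\beta=4/(4\alpha-1)$, and let $\varepsilon,d,q_{\max}$ be real numbers with $0<\varepsilon<1<d$ and $q_{\max}>1$. Then the ILLL algorithm (as described in the context) with input $A,\varepsilon,d,q_{\max}$ and reduction parameter $\alpha$ finds a sequence of $m$-tuples $(q_1,\dots,q_m)$ of integers such that for every real $Q$ with $$\varepsilon^{-\frac{n}{m}}\,\beta^{\frac{(m+n-1)(m+n)}{4m}}\le Q\le q_{\max},$$ one of these $m$-tuples satisfies $$\max_{1\le j\le m}|q_j|\le Q$$ and $$\max_{1\le i\le n}\|q_1a_{i1}+\cdots+q_ma_{im}\|\le d\,Q^{-\frac{m}{n}}\,\beta^{\frac{(m+n-1)(m+n)}{4n}}.$$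
   Context: For real $x$, $\|x\|$ denotes the distance from $x$ to the nearest integer. LLL algorithm. Let $\vec b_1,\dots,\vec b_N$ be a basis of $\mathbb{R}^N$, with Gram-Schmidt vectors $\vec b_i^*=\vec b_i-\sum_{j<i}\mu_{i,j}\vec b_j^*$, where $\mu_{i,j}=\langle \vec b_i,\vec b_j^*\rangle/\langle \vec b_j^*,\vec b_j^*\rangle$. For a reduction parameter $1/4<\alpha<1$, the LLL algorithm applied to a basis of a full-rank lattice $L\subset\mathbb{R}^N$ returns a basis $\vec b_1,\dots,\vec b_N$ of the same lattice $L$ such that $|\mu_{i,j}|\le \frac12$ for $1\le j<i\le N$ and $|\vec b_i^*+\mu_{i,i-1}\vec b_{i-1}^*|^2\ge \alpha|\vec b_{i-1}^*|^2$ for $2\le i\le N$. Throughout, $\beta=4/(4\alpha-1)$. Basis matrix. For a real $n\times m$ matrix $A$ and $c>0$, let $B_{A,c}$ be the $(n+m)\times(n+m)$ block matrix $$B_{A,c}=\begin{pmatrix} I_n & A\\ O & cI_m\end{pmatrix},$$ whose columns form a basis of a lattice in $\mathbb{R}^{n+m}$. For $0<\eta<1$ put $$c(\eta)=\beta^{\frac{(1-m-n)(n+m)}{4m}}\,\eta^{1+\frac nm}.$$ ILLL (iterated LLL) algorithm. Input: a real $n\times m$ matrix $A$, real numbers $\varepsilon,d$ with $0<\varepsilon<1<d$, a reduction parameter $1/4<\alpha<1$, and an upper bound $q_{\max}>1$. In iteration $k=1,2,\dots$: (1) Apply the LLL algorithm with parameter $\alpha$ to the columns of $B_{A,c_k}$,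 where $c_1=c(\varepsilon)$ and $c_{k+1}=c_k\,d^{-\frac{n+m}{m}}$ (so $c_k=c(\varepsilon d^{1-k})$). (2) Let $\vec b_1$ be the first vector of the returned basis, and write $\vec b_1=B_{A,c_k}\,(p_1,\dots,p_n,q_1,\dots,q_m)^T$ with integers $p_i,q_j$. This yields the $m$-tuple $q(k)=(q_1(k),\dots,q_m(k))=(q_1,\dots,q_m)$. (3) If $\max_{1\le j\le m}|q_j(k)|\le q_{\max}$, go on to iteration $k+1$; otherwise stop. The sequence of $m$-tuples found by the algorithm consists of the $q(k)$ for integers $1\le k\le k'$, where $$k'=\left\lceil \frac mn\log_d(q_{\max})+1+\log_d(\varepsilon)-\frac{(m+n-1)(m+n)}{4n}\log_d(\beta)\right\rceil .$$ *)

theory Defs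
  imports Complex_Main "Jordan_Normal_Form.Gram_Schmidt"
begin

definition dist_nearest_int :: "real \<Rightarrow> real" where
  "dist_nearest_int x = \<bar>x - of_int (round x)\<bar>"

definition max_abs :: "int vec \<Rightarrow> int" where
  "max_abs q = Max ((\<lambda>j. \<bar>q $ j\<bar>) ` {..<dim_vec q})"

definition is_real_basis :: "nat \<Rightarrow> real vec list \<Rightarrow> bool" where
  "is_real_basis N bs \<longleftrightarrow>
     length bs = N \<and> distinct bs \<and>
     vectorspace.basis class_ring (module_vec TYPE(real) N) (set bs)"

text \<open>Basis vectors are indexed from 0.
  The library function \<open>gram_schmidt\<close> orthogonalises without normalising.\<close>

definition gs_mu :: "nat \<Rightarrow> real vec list \<Rightarrow> nat \<Rightarrow> nat \<Rightarrow> real" where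
  "gs_mu N bs i j =
     (bs ! i \<bullet> gram_schmidt N bs ! j) / (gram_schmidt N bs ! j \<bullet> gram_schmidt N bs ! j)"

definition LLL_reduced :: "nat \<Rightarrow> real \<Rightarrow> real vec list \<Rightarrow> bool" where
  "LLL_reduced N \<alpha> bs \<longleftrightarrow>
     (\<forall>i<N. \<forall>j<i. \<bar>gs_mu N bs i j\<bar> \<le> 1 / 2) \<and>
     (\<forall>i. 1 \<le> i \<and> i < N \<longrightarrow>
        (let g = gram_schmidt N bs ! (i - 1);
             v = gram_schmidt N bs ! i + gs_mu N bs i (i - 1) \<cdot>\<^sub>v g
         in v \<bullet> v \<ge> \<alpha> * (g \<bullet> g)))"

text \<open>The input-output specification of the LLL algorithm with reduction parameter \<open>\<alpha>\<close>;
  an LLL algorithm is any procedure meeting it.\<close>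

definition LLL_algorithm :: "real \<Rightarrow> (real vec list \<Rightarrow> real vec list) \<Rightarrow> bool" where
  "LLL_algorithm \<alpha> lll \<longleftrightarrow>
     (\<forall>N bs. is_real_basis N bs \<longrightarrow>
        is_real_basis N (lll bs) \<and>
        vec_module.lattice_of N (lll bs) = vec_module.lattice_of N bs \<and>
        LLL_reduced N \<alpha> (lll bs))"

definition B_mat :: "nat \<Rightarrow> nat \<Rightarrow> real mat \<Rightarrow> real \<Rightarrow> real mat" where
  "B_mat n m A c = four_block_mat (1\<^sub>m n) A (0\<^sub>m m n) (c \<cdot>\<^sub>m 1\<^sub>m m)"

definition c_of :: "nat \<Rightarrow> nat \<Rightarrow> real \<Rightarrow> real \<Rightarrow> real" where
  "c_of n m \<alpha> \<eta> =
     (4 / (4 * \<alpha> - 1)) powr ((1 - real m - real n) * (real n + real m) / (4 * real m))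
     * \<eta> powr (1 + real n / real m)"

definition illl_tuple ::
  "(real vec list \<Rightarrow> real vec list) \<Rightarrow> nat \<Rightarrow> nat \<Rightarrow> real mat \<Rightarrow> real \<Rightarrow> int vec" where
  "illl_tuple lll n m A c =
     (THE q. q \<in> carrier_vec m \<and>
        (\<exists>p \<in> carrier_vec n.
           lll (cols (B_mat n m A c)) ! 0 = B_mat n m A c *\<^sub>v map_vec real_of_int (p @\<^sub>v q)))"

text \<open>The list of tuples produced by at most \<open>r\<close> iterations, the first one using the scale \<open>c\<close>.
  A tuple exceeding \<open>qmax\<close> is still produced, but ends the iteration.\<close>

fun illl_loop ::
  "(real vec list \<Rightarrow> real vec list) \<Rightarrow> nat \<Rightarrow> nat \<Rightarrow> real mat \<Rightarrow> real \<Rightarrow> real \<Rightarrow> nat \<Rightarrow> real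
    \<Rightarrow> int vec list" where
  "illl_loop lll n m A d qmax 0 c = []"
| "illl_loop lll n m A d qmax (Suc r) c =
     (let q = illl_tuple lll n m A c in
      q # (if real_of_int (max_abs q) \<le> qmax
           then illl_loop lll n m A d qmax r (c * d powr (- ((real n + real m) / real m)))
           else []))"

definition illl_bound ::
  "nat \<Rightarrow> nat \<Rightarrow> real \<Rightarrow> real \<Rightarrow> real \<Rightarrow> real \<Rightarrow> int" where
  "illl_bound n m \<epsilon> d \<alpha> qmax =
     \<lceil>real m / real n * log d qmax + 1 + log d \<epsilon>
       - (real m + real n - 1) * (real m + real n) / (4 * real n) * log d (4 / (4 * \<alpha> - 1))\<rceil>"

text \<open>The stopping test alone need not terminate the loop: for rational \<open>A\<close> the tuples can stay
  below \<open>qmax\<close> forever. Hence the explicit cap on the number of iterations. For a nonpositive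
  cap no tuple is produced.\<close>

definition illl ::
  "(real vec list \<Rightarrow> real vec list) \<Rightarrow> nat \<Rightarrow> nat \<Rightarrow> real mat \<Rightarrow> real \<Rightarrow> real \<Rightarrow> real \<Rightarrow> real
    \<Rightarrow> int vec list" where
  "illl lll n m A \<epsilon> d \<alpha> qmax =
     illl_loop lll n m A d qmax (nat (illl_bound n m \<epsilon> d \<alpha> qmax)) (c_of n m \<alpha> \<epsilon>)"

end

theory Submission
  imports Defs
begin

text \<open>For a reduced basis \<open>b\<^sub>1, \<dots>, b\<^sub>N\<close> the LLL conditions give \<open>|b\<^sub>1|\<^sup>2 \<le> \<beta>\<^sup>i\<^sup>-\<^sup>1 |b\<^sub>i\<^sup>*|\<^sup>2\<close>; multiplying over \<open>i\<close>
  and using that the product of the \<open>|b\<^sub>i\<^sup>*|\<^sup>2\<close> is the squared lattice determinant bounds \<open>|b\<^sub>1|\<close>.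
  The constant \<open>c(\<eta>)\<close> is chosen such that this bound becomes \<open>|b\<^sub>1| \<le> \<eta>\<close> for the lattice of \<open>B\<^sub>A\<^sub>,\<^sub>c\<close>,
  whose determinant is \<open>c\<^sup>m\<close>. Reading off the coordinates of \<open>b\<^sub>1\<close>, the tuple \<open>q\<close> has quality at most
  \<open>\<eta>\<close> and size at most \<open>\<eta> / c(\<eta>)\<close>. Since \<open>\<eta>\<close> runs through the geometric progression
  \<open>\<epsilon> d\<^sup>1\<^sup>-\<^sup>k\<close>, some iteration comes within a factor \<open>d\<close> of the optimal parameter for \<open>Q\<close>; the tuples
  of all earlier iterations have size at most \<open>Q \<le> q\<^sub>m\<^sub>a\<^sub>x\<close>, so the algorithm has not stopped before.\<close>

section \<open>Gram-Schmidt vectors in coordinates\<close>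

text \<open>The accumulator \<open>us\<close> collects the vectors already produced, most recent
  first, hence the \<open>rev\<close>. It must be arbitrary in the induction, since each step pushes
  a new vector onto it.\<close>

lemma gram_schmidt_sub2_nth:
  "length (gram_schmidt_sub2 n us ws) = length ws \<and>
   (\<forall>i<length ws. gram_schmidt_sub2 n us ws ! i =
      adjuster n (ws ! i) (rev (take i (gram_schmidt_sub2 n us ws)) @ us) + ws ! i)"
proof (induction ws arbitrary: us)
  case (Cons w ws)
  let ?u = "adjuster n w us + w"
  have IH: "length (gram_schmidt_sub2 n (?u # us) ws) = length ws"
    "\<And>i. i < length ws \<Longrightarrow> gram_schmidt_sub2 n (?u # us) ws ! i =
      adjuster n (ws ! i) (rev (take i (gram_schmidt_sub2 n (?u # us) ws)) @ ?u # us) + ws ! i"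
    using Cons.IH[of "?u # us"] by blast+
  show ?case
  proof (intro conjI allI impI)
    fix i assume "i < length (w # ws)"
    then show "gram_schmidt_sub2 n us (w # ws) ! i =
      adjuster n ((w # ws) ! i) (rev (take i (gram_schmidt_sub2 n us (w # ws))) @ us) + (w # ws) ! i"
      using IH(2)[of "i - 1"] by (cases i) (simp_all add: Let_def)
  qed (simp add: IH(1) Let_def)
qed simp

lemma length_gram_schmidt: "length (gram_schmidt n ws) = length ws"
  by (simp add: gram_schmidt_code gram_schmidt_sub2_nth)

lemma gram_schmidt_nth:
  "i < length ws \<Longrightarrow>
   gram_schmidt n ws ! i = adjuster n (ws ! i) (rev (take i (gram_schmidt n ws))) + ws ! i"
  using gram_schmidt_sub2_nth[of n "[]" ws] by (simp add: gram_schmidt_code)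

lemma adjuster_index:
  fixes us :: "real vec list"
  assumes "set us \<subseteq> carrier_vec n" and "k < n"
  shows "dim_vec (adjuster n w us) = n \<and>
    adjuster n w us $ k = - (\<Sum>u\<leftarrow>us. (w \<bullet> u) / (u \<bullet> u) * u $ k)"
  using assms by (induction us) auto

lemma is_real_basisD:
  assumes "is_real_basis N bs"
  shows "length bs = N" and "distinct bs" and "set bs \<subseteq> carrier_vec N"
    and "\<not> module.lin_dep class_ring (module_vec TYPE(real) N) (set bs)"
proof -
  interpret vec_space "TYPE(real)" N .
  show "length bs = N" "distinct bs" "set bs \<subseteq> carrier_vec N"
    "\<not> module.lin_dep class_ring (module_vec TYPE(real) N) (set bs)"
    using assms by (auto simp: is_real_basis_def basis_def)
qed

lemma gram_schmidt_basis:
  assumes "is_real_basis N bs"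
  shows "set (gram_schmidt N bs) \<subseteq> carrier_vec N"
    and "\<And>i j. i < N \<Longrightarrow> j < N \<Longrightarrow> i \<noteq> j \<Longrightarrow>
          gram_schmidt N bs ! i \<bullet> gram_schmidt N bs ! j = 0"
proof -
  interpret cof_vec_space N "TYPE(real)" .
  note gs = gram_schmidt_result[OF is_real_basisD(3,2,4)[OF assms] refl]
  show "set (gram_schmidt N bs) \<subseteq> carrier_vec N" by (rule gs(3))
  fix i j assume "i < N" "j < N" "i \<noteq> j"
  then show "gram_schmidt N bs ! i \<bullet> gram_schmidt N bs ! j = 0"
    using corthogonalD[OF gs(2), of i j] is_real_basisD(1)[OF assms] length_gram_schmidt[of N bs]
    by simp
qed

text \<open>The Gram-Schmidt recursion solved for \<open>bs ! i\<close>. Read entrywise, it is one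
  row of the factorisation that computes the determinant below.\<close>

lemma gram_schmidt_expansion:
  assumes "is_real_basis N bs" and i: "i < N" and k: "k < N"
  shows "bs ! i $ k = gram_schmidt N bs ! i $ k + (\<Sum>j<i. gs_mu N bs i j * gram_schmidt N bs ! j $ k)"
proof -
  let ?g = "gram_schmidt N bs"
  have len: "length bs = N" "length ?g = N"
    using is_real_basisD(1)[OF assms(1)] by (simp_all add: length_gram_schmidt)
  have sub: "set (rev (take i ?g)) \<subseteq> carrier_vec N"
    using gram_schmidt_basis(1)[OF assms(1)] set_take_subset by fastforce
  have "take i ?g = map ((!) ?g) [0..<i]"
    using i len by (intro nth_equalityI) auto
  then have "(\<Sum>u\<leftarrow>rev (take i ?g). (bs ! i \<bullet> u) / (u \<bullet> u) * u $ k)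
      = (\<Sum>u\<leftarrow>map ((!) ?g) [0..<i]. (bs ! i \<bullet> u) / (u \<bullet> u) * u $ k)"
    by (simp only: rev_map[symmetric] sum_list_rev)
  also have "\<dots> = (\<Sum>j<i. gs_mu N bs i j * ?g ! j $ k)"
    by (simp add: gs_mu_def interv_sum_list_conv_sum_set_nat comp_def atLeast0LessThan)
  finally have "(\<Sum>u\<leftarrow>rev (take i ?g). (bs ! i \<bullet> u) / (u \<bullet> u) * u $ k)
      = (\<Sum>j<i. gs_mu N bs i j * ?g ! j $ k)" .
  moreover have "bs ! i \<in> carrier_vec N"
    using is_real_basisD(1,3)[OF assms(1)] i by auto
  ultimately show ?thesis
    using gram_schmidt_nth[of i bs N] adjuster_index[OF sub k, of "bs ! i"] i k len by simp
qed

lemma gram_schmidt_hd_nth: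
  assumes "is_real_basis N bs" "0 < N"
  shows "gram_schmidt N bs ! 0 = bs ! 0"
proof (rule eq_vecI)
  have "gram_schmidt N bs ! 0 \<in> carrier_vec N"
    using gram_schmidt_basis(1)[OF assms(1)] assms is_real_basisD(1)[OF assms(1)]
    by (metis length_gram_schmidt nth_mem subsetD)
  moreover have "bs ! 0 \<in> carrier_vec N"
    using is_real_basisD(1,3)[OF assms(1)] assms(2) by auto
  ultimately show "dim_vec (gram_schmidt N bs ! 0) = dim_vec (bs ! 0)"
    and "\<And>k. k < dim_vec (bs ! 0) \<Longrightarrow> gram_schmidt N bs ! 0 $ k = bs ! 0 $ k"
    using gram_schmidt_expansion[OF assms(1,2)] by auto
qed

section \<open>Determinant and first vector of a reduced basis\<close>

text \<open>The matrix of basis rows factors as \<open>L * G\<close>, with \<open>L\<close> the unit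
  lower triangular matrix of the coefficients \<open>gs_mu\<close> and \<open>G\<close> the
  Gram-Schmidt rows. So its determinant is \<open>det G\<close>, and \<open>G * G\<^sup>T\<close> is
  diagonal by orthogonality.\<close>

lemma det_square_gram_schmidt:
  assumes "is_real_basis N bs"
  shows "(det (mat_of_rows N bs))\<^sup>2 = (\<Prod>i<N. gram_schmidt N bs ! i \<bullet> gram_schmidt N bs ! i)"
proof -
  let ?g = "gram_schmidt N bs"
  define G where "G = mat_of_rows N ?g"
  define L where "L = mat N N (\<lambda>(i,j). if j < i then gs_mu N bs i j else if j = i then 1 else 0)"
  have len: "length bs = N" "length ?g = N"
    using is_real_basisD(1)[OF assms(1)] by (simp_all add: length_gram_schmidt)
  have gc: "?g ! i \<in> carrier_vec N" if "i < N" for i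
    using gram_schmidt_basis(1)[OF assms(1)] that len by auto
  have G: "G \<in> carrier_mat N N" and L: "L \<in> carrier_mat N N"
    using len by (auto simp: G_def L_def)
  have "mat_of_rows N bs = L * G"
  proof (rule eq_matI)
    fix i k assume "i < dim_row (L * G)" "k < dim_col (L * G)"
    then have ik: "i < N" "k < N" using G L by auto
    have "(L * G) $$ (i,k) = (\<Sum>j\<in>{..<N}. L $$ (i,j) * G $$ (j,k))"
      using ik G L by (simp add: scalar_prod_def atLeast0LessThan)
    also have "\<dots> = (\<Sum>j\<in>{..<i} \<union> {i}. L $$ (i,j) * G $$ (j,k))"
      using ik by (intro sum.mono_neutral_right) (auto simp: L_def)
    also have "\<dots> = ?g ! i $ k + (\<Sum>j<i. gs_mu N bs i j * ?g ! j $ k)"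
      using ik len by (simp add: L_def G_def mat_of_rows_index)
    finally show "mat_of_rows N bs $$ (i,k) = (L * G) $$ (i,k)"
      using gram_schmidt_expansion[OF assms(1) ik] ik len by (simp add: mat_of_rows_index)
  qed (use G L len in auto)
  moreover have "det L = 1"
    by (subst det_lower_triangular[OF _ L]) (auto simp: L_def prod_list_diag_prod)
  ultimately have "det (mat_of_rows N bs) = det G"
    using det_mult[OF L G] by simp
  then have "(det (mat_of_rows N bs))\<^sup>2 = det (G * G\<^sup>T)"
    using det_mult[of G N "G\<^sup>T"] det_transpose[OF G] G by (simp add: power2_eq_square)
  moreover have GG: "(G * G\<^sup>T) $$ (i,j) = ?g ! i \<bullet> ?g ! j" if "i < N" "j < N" for i j
    using that G len gc by (simp add: G_def)
  have "det (G * G\<^sup>T) = (\<Prod>i<N. ?g ! i \<bullet> ?g ! i)"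
  proof (subst det_upper_triangular)
    show "upper_triangular (G * G\<^sup>T)"
      using G GG gram_schmidt_basis(2)[OF assms(1)] by (auto simp: upper_triangular_def)
    show "G * G\<^sup>T \<in> carrier_mat N N" using G by auto
    show "prod_list (diag_mat (G * G\<^sup>T)) = (\<Prod>i<N. ?g ! i \<bullet> ?g ! i)"
      unfolding prod_list_diag_prod using G
      by (intro prod.cong) (auto simp: GG simp del: index_mult_mat(1))
  qed
  ultimately show ?thesis by simp
qed

text \<open>By orthogonality the Lovasz condition bounds the next squared norm from below by
  \<alpha> - \<open>?\<mu>\<^sup>2\<close> times the current one. Since
  \<open>?\<mu>\<^sup>2\<close> is at most 1/4, each step costs at most the factor 1 / (\<alpha> -
  1/4), which is \<beta>.\<close>

lemma LLL_reduced_gram_schmidt_le: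
  fixes \<alpha> :: real
  assumes bs: "is_real_basis N bs" and red: "LLL_reduced N \<alpha> bs" and \<alpha>: "1 / 4 < \<alpha>" and "i < N"
  shows "bs ! 0 \<bullet> bs ! 0 \<le> (4 / (4 * \<alpha> - 1)) ^ i * (gram_schmidt N bs ! i \<bullet> gram_schmidt N bs ! i)"
  using \<open>i < N\<close>
proof (induction i)
  case 0
  then show ?case using gram_schmidt_hd_nth[OF bs] by simp
next
  case (Suc i)
  let ?\<beta> = "4 / (4 * \<alpha> - 1)"
  let ?g = "\<lambda>i. gram_schmidt N bs ! i" and ?\<mu> = "gs_mu N bs (Suc i) i"
  have gc: "?g i \<in> carrier_vec N" if "i < N" for i
    using gram_schmidt_basis(1)[OF bs] that is_real_basisD(1)[OF bs]
    by (metis length_gram_schmidt nth_mem subsetD)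
  have g: "?g i \<in> carrier_vec N" "?g (Suc i) \<in> carrier_vec N"
    and o: "?g i \<bullet> ?g (Suc i) = 0" "?g (Suc i) \<bullet> ?g i = 0"
    using Suc.prems gram_schmidt_basis(2)[OF bs] by (auto intro: gc)
  let ?v = "?g (Suc i) + ?\<mu> \<cdot>\<^sub>v ?g i"
  have "\<bar>?\<mu>\<bar> \<le> 1 / 2" and lov: "\<alpha> * (?g i \<bullet> ?g i) \<le> ?v \<bullet> ?v"
    using red Suc.prems unfolding LLL_reduced_def Let_def
    by (blast, metis Suc_eq_plus1 add_diff_cancel_right' le_add2)
  then have mu: "?\<mu>\<^sup>2 \<le> 1 / 4"
    using power_mono[of "\<bar>?\<mu>\<bar>" "1/2" 2] by (simp add: power2_eq_square)
  have nn: "0 \<le> ?g i \<bullet> ?g i"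
    by (simp add: scalar_prod_def sum_nonneg)
  have "?v \<bullet> ?v = ?g (Suc i) \<bullet> ?g (Suc i) + ?\<mu>\<^sup>2 * (?g i \<bullet> ?g i)"
    using g o by (simp add: scalar_prod_add_distrib[of _ N] add_scalar_prod_distrib[of _ N] power2_eq_square)
  then have "(\<alpha> - 1 / 4) * (?g i \<bullet> ?g i) \<le> ?g (Suc i) \<bullet> ?g (Suc i)"
    using lov mult_right_mono[OF mu nn] by (simp add: algebra_simps)
  then have "?g i \<bullet> ?g i \<le> ?\<beta> * (?g (Suc i) \<bullet> ?g (Suc i))"
    using \<alpha> by (simp add: field_simps)
  then have "?\<beta> ^ i * (?g i \<bullet> ?g i) \<le> ?\<beta> ^ i * (?\<beta> * (?g (Suc i) \<bullet> ?g (Suc i)))"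
    using \<alpha> by (intro mult_left_mono) auto
  then show ?case using Suc by (simp add: mult.assoc mult.left_commute)
qed

lemma LLL_reduced_first_vector_le:
  fixes \<alpha> :: real
  assumes bs: "is_real_basis N bs" and red: "LLL_reduced N \<alpha> bs" and \<alpha>: "1 / 4 < \<alpha>"
  shows "(bs ! 0 \<bullet> bs ! 0) ^ N \<le> (4 / (4 * \<alpha> - 1)) ^ (\<Sum>i<N. i) * (det (mat_of_rows N bs))\<^sup>2"
proof -
  have "(bs ! 0 \<bullet> bs ! 0) ^ N = (\<Prod>i<N. bs ! 0 \<bullet> bs ! 0)" by simp
  also have "\<dots> \<le> (\<Prod>i<N. (4 / (4 * \<alpha> - 1)) ^ i * (gram_schmidt N bs ! i \<bullet> gram_schmidt N bs ! i))"
    using LLL_reduced_gram_schmidt_le[OF assms]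
    by (intro prod_mono) (auto simp: scalar_prod_def sum_nonneg)
  also have "\<dots> = (4 / (4 * \<alpha> - 1)) ^ (\<Sum>i<N. i) * (det (mat_of_rows N bs))\<^sup>2"
    by (simp add: prod.distrib det_square_gram_schmidt[OF bs] power_sum)
  finally show ?thesis .
qed

section \<open>Lattices, sublattices and bases\<close>

text \<open>Lattice membership in coordinates; it supplies both the integer matrix relating two
  bases and the integers p and q of an iteration.\<close>

lemma lattice_of_index:
  fixes bs :: "real vec list"
  assumes "v \<in> vec_module.lattice_of N bs" and "set bs \<subseteq> carrier_vec N"
  obtains z where "v \<in> carrier_vec N"
    "\<And>k. k < N \<Longrightarrow> v $ k = (\<Sum>i<length bs. of_int (z i) * bs ! i $ k)"
proof -
  interpret vec_module "TYPE(real)" N .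
  obtain z where v: "v = sumlist (map (\<lambda>i. of_int (z i) \<cdot>\<^sub>v bs ! i) [0..<length bs])"
    using in_latticeE[OF assms(1)] .
  have *: "x \<in> carrier_vec N" if "x \<in> set (map (\<lambda>i. of_int (z i) \<cdot>\<^sub>v bs ! i) [0..<length bs])" for x
    using that assms(2) by (auto simp: subset_iff)
  show ?thesis
  proof (rule that[of z])
    show "v \<in> carrier_vec N" unfolding v using * by (intro sumlist_carrier) auto
    fix k assume k: "k < N"
    have "v $ k = (\<Sum>i\<leftarrow>[0..<length bs]. (of_int (z i) \<cdot>\<^sub>v bs ! i) $ k)"
      unfolding v by (subst sumlist_vec_index[OF * k]) (simp_all add: comp_def)
    also have "\<dots> = (\<Sum>i<length bs. (of_int (z i) \<cdot>\<^sub>v bs ! i) $ k)"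
      by (simp add: interv_sum_list_conv_sum_set_nat atLeast0LessThan)
    also have "\<dots> = (\<Sum>i<length bs. of_int (z i) * bs ! i $ k)"
    proof (rule sum.cong[OF refl])
      fix i assume "i \<in> {..<length bs}"
      then have "bs ! i \<in> carrier_vec N" using assms(2) by auto
      then show "(of_int (z i) \<cdot>\<^sub>v bs ! i) $ k = of_int (z i) * bs ! i $ k" using k by simp
    qed
    finally show "v $ k = (\<Sum>i<length bs. of_int (z i) * bs ! i $ k)" .
  qed
qed

text \<open>The coefficients of \<open>cs\<close> in terms of \<open>bs\<close> form an integer
  matrix, and the determinant of an integer matrix is an integer.\<close>

lemma det_sublattice:
  fixes bs cs :: "real vec list"
  assumes "length bs = N" "length cs = N" "set bs \<subseteq> carrier_vec N"
    and sub: "set cs \<subseteq> vec_module.lattice_of N bs"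
  obtains z :: int where "det (mat_of_rows N cs) = of_int z * det (mat_of_rows N bs)"
proof -
  have "\<exists>z. \<forall>k<N. cs ! i $ k = (\<Sum>j<N. of_int (z j) * bs ! j $ k)" if "i < N" for i
  proof -
    have "cs ! i \<in> vec_module.lattice_of N bs" using that assms(2) sub by auto
    then show ?thesis using lattice_of_index[OF _ assms(3)] assms(1) by metis
  qed
  then obtain z where z: "\<And>i k. i < N \<Longrightarrow> k < N \<Longrightarrow> cs ! i $ k = (\<Sum>j<N. of_int (z i j) * bs ! j $ k)"
    by metis
  define Z where "Z = mat N N (\<lambda>(i,j). z i j :: int)"
  let ?Z = "map_mat real_of_int Z"
  have Z: "?Z \<in> carrier_mat N N" by (simp add: Z_def)
  have B: "mat_of_rows N bs \<in> carrier_mat N N" using assms by auto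
  have "mat_of_rows N cs = ?Z * mat_of_rows N bs"
    using assms(1,2)
    by (intro eq_matI) (auto simp: z Z_def mat_of_rows_index scalar_prod_def atLeast0LessThan)
  then have "det (mat_of_rows N cs) = of_int (det Z) * det (mat_of_rows N bs)"
    using det_mult[OF Z B] by (simp add: of_int_hom.hom_det)
  then show ?thesis using that by blast
qed

text \<open>Independence is a property of the set of columns and would overlook a repeated column,
  so distinctness is derived separately: equal columns make the determinant vanish. Counting
  dimensions then gives a basis.\<close>

lemma det_nonzero_imp_basis_cols:
  assumes M: "M \<in> carrier_mat N N" and det: "det M \<noteq> 0"
  shows "is_real_basis N (cols M)"
proof -
  interpret vec_space "TYPE(real)" N .
  have dist: "distinct (cols M)"
    unfolding distinct_conv_nth
    using det_identical_columns[OF M] det M by (metis carrier_matD(2) cols_length cols_nth)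
  have "lin_indpt (set (cols M))"
    using lin_dep_cols_imp_det_0[OF M] det by blast
  moreover have "set (cols M) \<subseteq> carrier_vec N"
    using M cols_dim by blast
  moreover have "card (set (cols M)) = dim"
    using dist M by (simp add: distinct_card dim_is_n)
  ultimately have "basis (set (cols M))"
    by (intro dim_li_is_basis) (auto simp: fin_dim)
  then show ?thesis using dist M by (simp add: is_real_basis_def)
qed

section \<open>The lattice of \<open>B_mat\<close> and its reduced basis\<close>

lemma B_mat_carrier:
  "A \<in> carrier_mat n m \<Longrightarrow> B_mat n m A c \<in> carrier_mat (n + m) (n + m)"
  by (simp add: B_mat_def)

lemma det_B_mat: "A \<in> carrier_mat n m \<Longrightarrow> det (B_mat n m A c) = c ^ m"
  unfolding B_mat_def
  by (subst det_four_block_mat_lower_left_zero[of _ n _ m]) (auto simp: det_smult)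

lemma B_mat_mult_index:
  fixes c :: real
  assumes A: "A \<in> carrier_mat n m" and p: "p \<in> carrier_vec n" and q: "q \<in> carrier_vec m"
  defines "v \<equiv> B_mat n m A c *\<^sub>v map_vec real_of_int (p @\<^sub>v q)"
  shows "i < n \<Longrightarrow> v $ i = of_int (p $ i) + (\<Sum>j<m. of_int (q $ j) * A $$ (i, j))"
    and "j < m \<Longrightarrow> v $ (n + j) = c * of_int (q $ j)"
proof -
  have "map_vec real_of_int (p @\<^sub>v q) = map_vec real_of_int p @\<^sub>v map_vec real_of_int q"
    using p q by (intro eq_vecI) auto
  moreover have "map_vec real_of_int p \<in> carrier_vec n" "map_vec real_of_int q \<in> carrier_vec m"
    using p q by auto
  ultimately have v: "v = (1\<^sub>m n *\<^sub>v map_vec real_of_int p + A *\<^sub>v map_vec real_of_int q) @\<^sub>v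
      (0\<^sub>m m n *\<^sub>v map_vec real_of_int p + (c \<cdot>\<^sub>m 1\<^sub>m m) *\<^sub>v map_vec real_of_int q)"
    using A unfolding v_def B_mat_def by (simp add: four_block_mat_mult_vec[of _ n n _ m _ m])
  show "v $ i = of_int (p $ i) + (\<Sum>j<m. of_int (q $ j) * A $$ (i, j))" if "i < n"
    using that A p q unfolding v
    by (simp add: scalar_prod_def atLeast0LessThan mult.commute)
  show "v $ (n + j) = c * of_int (q $ j)" if j: "j < m"
  proof -
    have "row (c \<cdot>\<^sub>m 1\<^sub>m m) j = c \<cdot>\<^sub>v unit_vec m j" using j by auto
    then show ?thesis
      using j A p q unfolding v by simp
  qed
qed

lemma lll_B_mat:
  assumes A: "A \<in> carrier_mat n m" and c: "c \<noteq> 0" and lll: "LLL_algorithm \<alpha> lll"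
  defines "bs \<equiv> lll (cols (B_mat n m A c))"
  shows "is_real_basis (n + m) bs" and "LLL_reduced (n + m) \<alpha> bs"
    and "vec_module.lattice_of (n + m) bs = vec_module.lattice_of (n + m) (cols (B_mat n m A c))"
proof -
  have "is_real_basis (n + m) (cols (B_mat n m A c))"
    using det_nonzero_imp_basis_cols[OF B_mat_carrier[OF A]] det_B_mat[OF A] c by simp
  then show "is_real_basis (n + m) bs" "LLL_reduced (n + m) \<alpha> bs"
    "vec_module.lattice_of (n + m) bs = vec_module.lattice_of (n + m) (cols (B_mat n m A c))"
    using lll unfolding LLL_algorithm_def bs_def by blast+
qed

lemma set_subset_lattice_of:
  fixes bs :: "real vec list"
  assumes "is_real_basis N bs"
  shows "set bs \<subseteq> vec_module.lattice_of N bs"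
proof -
  interpret vec_module "TYPE(real)" N .
  show ?thesis using basis_in_latticeI is_real_basisD[OF assms] by blast
qed

text \<open>The columns of \<open>B_mat\<close> lie in the lattice of the output, so
  \<open>c ^ m\<close> is an integer multiple of the output determinant. The multiplier is nonzero
  because c is, hence the output determinant is at most \<open>c ^ m\<close> in absolute
  value.\<close>

lemma lll_B_mat_first_vector_le:
  fixes \<alpha> c :: real
  assumes A: "A \<in> carrier_mat n m" and c: "c \<noteq> 0" and lll: "LLL_algorithm \<alpha> lll"
    and \<alpha>: "1 / 4 < \<alpha>"
  defines "v \<equiv> lll (cols (B_mat n m A c)) ! 0"
  shows "(v \<bullet> v) ^ (n + m) \<le> (4 / (4 * \<alpha> - 1)) ^ (\<Sum>i<n+m. i) * (c ^ m)\<^sup>2"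
proof -
  let ?N = "n + m"
  let ?B = "B_mat n m A c"
  let ?bs = "lll (cols ?B)"
  note bs = lll_B_mat[OF A c lll]
  have B: "?B \<in> carrier_mat ?N ?N" by (rule B_mat_carrier[OF A])
  have bB: "is_real_basis ?N (cols ?B)"
    using det_nonzero_imp_basis_cols[OF B] det_B_mat[OF A] c by simp
  obtain z :: int where "det (mat_of_rows ?N (cols ?B)) = of_int z * det (mat_of_rows ?N ?bs)"
    using det_sublattice[of ?bs ?N "cols ?B"] is_real_basisD[OF bs(1)] is_real_basisD(1)[OF bB]
      set_subset_lattice_of[OF bB] bs(3) by metis
  moreover have "mat_of_rows ?N (cols ?B) = ?B\<^sup>T"
    using B by (metis carrier_matD(1) mat_of_cols_cols transpose_mat_of_cols)
  ultimately have z: "c ^ m = of_int z * det (mat_of_rows ?N ?bs)"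
    using det_transpose[OF B] det_B_mat[OF A] by simp
  then have "1 \<le> \<bar>z\<bar>" using c by (cases "z = 0") auto
  then have "1 \<le> \<bar>real_of_int z\<bar>" by linarith
  then have "\<bar>det (mat_of_rows ?N ?bs)\<bar> \<le> \<bar>c ^ m\<bar>"
    unfolding z abs_mult by (simp add: mult_le_cancel_right1)
  then have d: "(det (mat_of_rows ?N ?bs))\<^sup>2 \<le> (c ^ m)\<^sup>2"
    by (rule abs_le_square_iff[THEN iffD1])
  show ?thesis
    unfolding v_def using \<alpha>
    by (intro order_trans[OF LLL_reduced_first_vector_le[OF bs(1,2) \<alpha>]] mult_left_mono[OF d]) simp
qed

section \<open>Quality and size of the tuple of one iteration\<close>

text \<open>Justifies the definite description in \<open>illl_tuple\<close>: a tuple exists because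
  the first output vector lies in the lattice, and it is unique because the last m coordinates of
  that vector are c times the tuple.\<close>

lemma illl_tuple_spec:
  assumes A: "A \<in> carrier_mat n m" and c: "c \<noteq> 0" and lll: "LLL_algorithm \<alpha> lll" and "n \<ge> 1"
  defines "q \<equiv> illl_tuple lll n m A c"
  shows "q \<in> carrier_vec m"
    and "\<exists>p \<in> carrier_vec n. lll (cols (B_mat n m A c)) ! 0 =
           B_mat n m A c *\<^sub>v map_vec real_of_int (p @\<^sub>v q)"
proof -
  let ?N = "n + m" and ?B = "B_mat n m A c"
  let ?v = "lll (cols ?B) ! 0"
  let ?P = "\<lambda>q. q \<in> carrier_vec m \<and>
      (\<exists>p \<in> carrier_vec n. ?v = ?B *\<^sub>v map_vec real_of_int (p @\<^sub>v q))"
  note bs = lll_B_mat[OF A c lll]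
  have B: "?B \<in> carrier_mat ?N ?N" by (rule B_mat_carrier[OF A])
  have "?v \<in> set (lll (cols ?B))"
    using is_real_basisD(1)[OF bs(1)] \<open>n \<ge> 1\<close> by (intro nth_mem) simp
  then have "?v \<in> vec_module.lattice_of ?N (cols ?B)"
    using set_subset_lattice_of[OF bs(1)] bs(3) by blast
  moreover have "set (cols ?B) \<subseteq> carrier_vec ?N" using B cols_dim[of ?B] by simp
  ultimately obtain z where v: "?v \<in> carrier_vec ?N"
    "\<And>k. k < ?N \<Longrightarrow> ?v $ k = (\<Sum>i<?N. of_int (z i) * cols ?B ! i $ k)"
    using lattice_of_index[of ?v ?N "cols ?B"] B by (metis carrier_matD(2) cols_length)
  \<comment> \<open>The integer coefficients with respect to the columns, split at n according to
    the block structure.\<close>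
  define p where "p = vec n z"
  define q' where "q' = vec m (\<lambda>j. z (n + j))"
  have pq: "map_vec real_of_int (p @\<^sub>v q') = vec ?N (\<lambda>i. of_int (z i))"
    by (intro eq_vecI) (auto simp: p_def q'_def)
  have "?v = ?B *\<^sub>v map_vec real_of_int (p @\<^sub>v q')"
    unfolding pq using v B
    by (intro eq_vecI) (auto simp: scalar_prod_def atLeast0LessThan mult.commute)
  then have ex: "?P q'" by (auto simp: p_def q'_def)
  have uniq: "q1 = q2" if q1: "?P q1" and q2: "?P q2" for q1 q2
  proof (rule eq_vecI)
    fix j assume "j < dim_vec q2"
    then have j: "j < m" using q2 by auto
    then have "?v $ (n + j) = c * of_int (q1 $ j)" "?v $ (n + j) = c * of_int (q2 $ j)"
      using q1 q2 B_mat_mult_index(2)[OF A] by metis+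
    then show "q1 $ j = q2 $ j" using c by simp
  qed (use q1 q2 in auto)
  have "?P q" unfolding q_def illl_tuple_def by (rule theI[of ?P, OF ex uniq[OF _ ex]])
  then show "q \<in> carrier_vec m"
    and "\<exists>p \<in> carrier_vec n. ?v = ?B *\<^sub>v map_vec real_of_int (p @\<^sub>v q)" by blast+
qed

lemma dist_nearest_int_le: "dist_nearest_int x \<le> \<bar>x - of_int k\<bar>"
  unfolding dist_nearest_int_def
  using round_diff_minimal[of x k] by (simp add: abs_minus_commute)

lemma sum_lessThan_id: "real (\<Sum>i<N. i) = real N * (real N - 1) / 2"
  by (induction N) (auto simp: field_simps)

lemma c_of_pos: "1 / 4 < \<alpha> \<Longrightarrow> 0 < \<eta> \<Longrightarrow> 0 < c_of n m \<alpha> \<eta>"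
  by (simp add: c_of_def)

lemma lll_first_vector_le:
  fixes \<alpha> \<eta> :: real
  assumes A: "A \<in> carrier_mat n m" and lll: "LLL_algorithm \<alpha> lll"
    and \<alpha>: "1 / 4 < \<alpha>" and \<eta>: "0 < \<eta>" and n: "n \<ge> 1" and m: "m \<ge> 1"
  defines "v \<equiv> lll (cols (B_mat n m A (c_of n m \<alpha> \<eta>))) ! 0"
  shows "v \<bullet> v \<le> \<eta>\<^sup>2"
proof -
  let ?N = "n + m" and ?c = "c_of n m \<alpha> \<eta>" and ?\<beta> = "4 / (4 * \<alpha> - 1)"
  have \<beta>: "0 < ?\<beta>" using \<alpha> by simp
  have c: "0 < ?c" using c_of_pos \<alpha> \<eta> by blast
  have "(?c ^ m)\<^sup>2 = ?c powr (2 * real m)"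
    using c by (simp add: powr_realpow[symmetric] powr_powr mult.commute power_mult[symmetric] flip: of_nat_mult)
  also have "\<dots> = ?\<beta> powr ((1 - real m - real n) * (real n + real m) / (4 * real m) * (2 * real m))
      * \<eta> powr ((1 + real n / real m) * (2 * real m))"
    using \<beta> \<eta> by (simp add: c_of_def powr_mult powr_powr)
  \<comment> \<open>The exponent of \<beta> in \<open>c_of\<close> is chosen for this identity:
    squaring \<open>?c ^ m\<close> gives exactly the inverse of the power of \<beta> lost in the
    reduction bound, so only a power of \<eta> survives.\<close>
  also have "(1 - real m - real n) * (real n + real m) / (4 * real m) * (2 * real m)
      = - real (\<Sum>i<?N. i)"
    using m by (simp only: sum_lessThan_id) (simp add: field_simps)
  also have "(1 + real n / real m) * (2 * real m) = real (2 * ?N)"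
    using m by (simp add: field_simps)
  finally have "?\<beta> ^ (\<Sum>i<?N. i) * (?c ^ m)\<^sup>2
      = ?\<beta> powr real (\<Sum>i<?N. i) * ?\<beta> powr (- real (\<Sum>i<?N. i)) * \<eta> ^ (2 * ?N)"
    using powr_realpow[OF \<beta>, of "\<Sum>i<?N. i"] powr_realpow[OF \<eta>, of "2 * ?N"] by (simp only: mult.assoc)
  also have "\<dots> = (\<eta>\<^sup>2) ^ ?N"
    unfolding power_mult using \<beta> by (simp add: powr_add[symmetric])
  finally have "(v \<bullet> v) ^ ?N \<le> (\<eta>\<^sup>2) ^ ?N"
    using lll_B_mat_first_vector_le[OF A _ lll \<alpha>, of ?c] c unfolding v_def by simp
  then show ?thesis
    \<comment> \<open>The rule takes exponents of the form \<open>Suc k\<close>, hence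
      \<open>?N - 1\<close>.\<close>
    using power_le_imp_le_base[of "v \<bullet> v" "?N - 1" "\<eta>\<^sup>2"] n by simp
qed

lemma vec_index_le_norm:
  fixes v :: "real vec"
  assumes "v \<bullet> v \<le> \<eta>\<^sup>2" and "0 \<le> \<eta>" and "k < dim_vec v"
  shows "\<bar>v $ k\<bar> \<le> \<eta>"
proof -
  have "v $ k * v $ k \<le> v \<bullet> v"
    unfolding scalar_prod_def
    using assms(3) by (intro member_le_sum[of k _ "\<lambda>i. v $ i * v $ i"]) auto
  then show ?thesis
    using assms(1,2) abs_le_square_iff[of "v $ k" \<eta>] by (simp add: power2_eq_square)
qed

lemma illl_tuple_bounds:
  fixes \<alpha> \<eta> :: real
  assumes A: "A \<in> carrier_mat n m" and lll: "LLL_algorithm \<alpha> lll"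
    and \<alpha>: "1 / 4 < \<alpha>" and \<eta>: "0 < \<eta>" and n: "n \<ge> 1" and m: "m \<ge> 1"
  defines "q \<equiv> illl_tuple lll n m A (c_of n m \<alpha> \<eta>)"
  shows "q \<in> carrier_vec m"
    and "\<And>i. i < n \<Longrightarrow> dist_nearest_int (\<Sum>j<m. of_int (q $ j) * A $$ (i, j)) \<le> \<eta>"
    and "\<And>j. j < m \<Longrightarrow> \<bar>of_int (q $ j)\<bar> \<le>
      (4 / (4 * \<alpha> - 1)) powr ((real m + real n - 1) * (real m + real n) / (4 * real m))
        * \<eta> powr (- (real n / real m))"
proof -
  let ?c = "c_of n m \<alpha> \<eta>" and ?\<beta> = "4 / (4 * \<alpha> - 1)"
  let ?v = "lll (cols (B_mat n m A ?c)) ! 0"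
  have \<beta>: "0 < ?\<beta>" using \<alpha> by simp
  have c: "0 < ?c" using c_of_pos \<alpha> \<eta> by blast
  obtain p where q: "q \<in> carrier_vec m" and p: "p \<in> carrier_vec n"
    and v: "?v = B_mat n m A ?c *\<^sub>v map_vec real_of_int (p @\<^sub>v q)"
    using illl_tuple_spec[OF A _ lll n, of ?c] c unfolding q_def by auto
  have "dim_vec ?v = n + m" unfolding v using B_mat_carrier[OF A] by auto
  then have le: "\<bar>?v $ k\<bar> \<le> \<eta>" if "k < n + m" for k
    using vec_index_le_norm[OF lll_first_vector_le[OF A lll \<alpha> \<eta> n m]] \<eta> that by simp
  show "q \<in> carrier_vec m" by (rule q)
  show "dist_nearest_int (\<Sum>j<m. of_int (q $ j) * A $$ (i, j)) \<le> \<eta>" if i: "i < n" for i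
    \<comment> \<open>Coordinate i of the short vector is the linear form plus \<open>p $ i\<close>,
      so the integer \<open>- p $ i\<close> is within \<eta> of the form.\<close>
    using dist_nearest_int_le[of "\<Sum>j<m. of_int (q $ j) * A $$ (i, j)" "- p $ i"]
      le[of i] B_mat_mult_index(1)[OF A p q i, of ?c] i unfolding v[symmetric] by (simp add: add.commute)
  fix j assume j: "j < m"
  have "?c * \<bar>of_int (q $ j)\<bar> \<le> \<eta>"
    using le[of "n + j"] B_mat_mult_index(2)[OF A p q j, of ?c] j c unfolding v[symmetric]
    by (simp add: abs_mult)
  then have "\<bar>of_int (q $ j)\<bar> \<le> \<eta> / ?c" using c by (simp add: field_simps)
  also have "\<eta> / ?c = ?\<beta> powr (- ((1 - real m - real n) * (real n + real m) / (4 * real m)))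
      * (\<eta> powr 1 * \<eta> powr (- (1 + real n / real m)))"
    unfolding c_of_def powr_minus divide_inverse[of \<eta>] inverse_mult_distrib using \<eta>
    by (simp only: powr_one mult.left_commute)
  also have "\<eta> powr 1 * \<eta> powr (- (1 + real n / real m)) = \<eta> powr (- (real n / real m))"
    unfolding powr_add[symmetric] by simp
  also have "- ((1 - real m - real n) * (real n + real m) / (4 * real m))
      = (real m + real n - 1) * (real m + real n) / (4 * real m)"
    using m by (simp add: field_simps)
  finally show "\<bar>of_int (q $ j)\<bar> \<le>
      ?\<beta> powr ((real m + real n - 1) * (real m + real n) / (4 * real m)) * \<eta> powr (- (real n / real m))" .
qed

section \<open>Reaching the right iteration\<close>

text \<open>A tuple is emitted before its own stopping test, so only the tuples with index below k
  have to pass. The scale is arbitrary in the induction because each iteration hands on a smaller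
  one.\<close>

lemma illl_tuple_in_loop:
  assumes "k < r"
    and "\<And>i. i < k \<Longrightarrow> of_int (max_abs (illl_tuple lll n m A
            (c * (d powr (- ((real n + real m) / real m))) ^ i))) \<le> qmax"
  shows "illl_tuple lll n m A (c * (d powr (- ((real n + real m) / real m))) ^ k)
    \<in> set (illl_loop lll n m A d qmax r c)"
  using assms
proof (induction r arbitrary: c k)
  case (Suc r)
  let ?D = "d powr (- ((real n + real m) / real m))"
  show ?case
  proof (cases k)
    case 0
    then show ?thesis by (simp add: Let_def)
  next
    case (Suc l)
    have "illl_tuple lll n m A (c * ?D * ?D ^ l) \<in> set (illl_loop lll n m A d qmax r (c * ?D))"
    proof (rule Suc.IH)
      show "l < r" using Suc.prems(1) Suc by simp
      show "of_int (max_abs (illl_tuple lll n m A (c * ?D * ?D ^ i))) \<le> qmax" if "i < l" for i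
        using Suc.prems(2)[of "Suc i"] that Suc by (simp add: mult.assoc)
    qed
    moreover have "of_int (max_abs (illl_tuple lll n m A c)) \<le> qmax"
      using Suc.prems(2)[of 0] Suc by simp
    ultimately show ?thesis using Suc by (simp add: Let_def mult.assoc)
  qed
qed simp

text \<open>Since \<open>c_of\<close> is proportional to \<eta> to the power 1 + n/m, the update of
  the scale amounts to dividing \<eta> by d.\<close>

lemma c_of_scale:
  assumes "0 < \<epsilon>" "0 < d" "m \<ge> 1"
  shows "c_of n m \<alpha> \<epsilon> * (d powr (- ((real n + real m) / real m))) ^ k = c_of n m \<alpha> (\<epsilon> * d powr (- real k))"
proof -
  have "(d powr (- ((real n + real m) / real m))) ^ k
      = d powr (- real k * (1 + real n / real m))"
    using assms by (simp add: powr_realpow[symmetric] powr_powr algebra_simps add_divide_distrib)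
  then show ?thesis
    using assms by (simp add: c_of_def powr_mult powr_powr)
qed

lemma max_abs_le_iff:
  assumes "q \<in> carrier_vec m" and "m \<ge> 1"
  shows "real_of_int (max_abs q) \<le> x \<longleftrightarrow> (\<forall>j<m. \<bar>of_int (q $ j)\<bar> \<le> x)"
proof -
  have "real_of_int (max_abs q) \<le> x \<longleftrightarrow> max_abs q \<le> \<lfloor>x\<rfloor>" by (simp add: le_floor_iff)
  also have "\<dots> \<longleftrightarrow> (\<forall>j<m. \<bar>q $ j\<bar> \<le> \<lfloor>x\<rfloor>)"
    unfolding max_abs_def using assms by (subst Max_le_iff) (auto simp: lessThan_empty_iff)
  finally show ?thesis by (simp add: le_floor_iff)
qed

theorem theorem3:
  fixes n m :: nat and A :: "real mat" and \<alpha> \<beta> \<epsilon> d qmax :: real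
    and lll :: "real vec list \<Rightarrow> real vec list"
  assumes "n \<ge> 1" and "m \<ge> 1"
    and "A \<in> carrier_mat n m"
    and "1 / 4 < \<alpha>" and "\<alpha> < 1"
    and "\<beta> = 4 / (4 * \<alpha> - 1)"
    and "0 < \<epsilon>" and "\<epsilon> < 1" and "1 < d" and "qmax > 1"
    and "LLL_algorithm \<alpha> lll"
  shows "\<forall>Q::real.
     \<epsilon> powr (- (real n / real m))
       * \<beta> powr ((real m + real n - 1) * (real m + real n) / (4 * real m)) \<le> Q \<and> Q \<le> qmax \<longrightarrow>
     (\<exists>q \<in> set (illl lll n m A \<epsilon> d \<alpha> qmax).
        q \<in> carrier_vec m \<and>
        real_of_int (Max ((\<lambda>j. \<bar>q $ j\<bar>) ` {..<m})) \<le> Q \<and>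
        Max ((\<lambda>i. dist_nearest_int (\<Sum>j<m. real_of_int (q $ j) * A $$ (i, j))) ` {..<n})
          \<le> d * Q powr (- (real m / real n))
              * \<beta> powr ((real m + real n - 1) * (real m + real n) / (4 * real n)))"
proof (intro allI impI, elim conjE)
  fix Q :: real
  define e where "e = (real m + real n - 1) * (real m + real n) / 4"
  have em: "(real m + real n - 1) * (real m + real n) / (4 * real m) = e / real m"
    and en: "(real m + real n - 1) * (real m + real n) / (4 * real n) = e / real n"
    by (simp_all add: e_def)
  assume lo: "\<epsilon> powr (- (real n / real m))
       * \<beta> powr ((real m + real n - 1) * (real m + real n) / (4 * real m)) \<le> Q" and hi: "Q \<le> qmax"
  note lo = lo[unfolded em]
  have n: "0 < real n" and m: "0 < real m" using assms(1,2) by simp_all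
  have \<beta>: "0 < \<beta>" using assms(4,6) by simp
  have \<epsilon>: "0 < \<epsilon>" and d: "1 < d" "0 < d" using assms(7,9) by simp_all
  have Q: "0 < Q" using lo \<epsilon> \<beta> by (smt (verit) mult_pos_pos powr_gt_zero)
  \<comment> \<open>With parameter \<open>\<eta> = d powr lt\<close>, the denominator bound of \<open>illl_tuple_bounds\<close> equals \<open>Q\<close>.\<close>
  define lt where "lt = - (real m / real n) * log d Q + e / real n * log d \<beta>"
  \<comment> \<open>The lower bound on Q says that the initial parameter \<epsilon> is at least
    \<open>d powr lt\<close>, so the floor defining k below is nonnegative and \<open>nat\<close>
    does not truncate.\<close>
  have "- (real n / real m) * log d \<epsilon> + e / real m * log d \<beta> \<le> log d Q"
    using log_le_cancel_iff[OF d(1) _ Q, THEN iffD2, OF _ lo] \<epsilon> \<beta> by (simp add: log_mult log_powr)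
  then have lt_le: "lt \<le> log d \<epsilon>"
    using n m by (simp add: lt_def field_simps)
  \<comment> \<open>The last iteration whose parameter is still at least \<open>d powr lt\<close>, so within a factor \<open>d\<close> of it.\<close>
  define k where "k = nat \<lfloor>log d \<epsilon> - lt\<rfloor>"
  have k: "real k \<le> log d \<epsilon> - lt" "log d \<epsilon> - lt < real k + 1"
    using lt_le by (simp_all add: k_def)
  \<comment> \<open>Iterations are counted from 0 here, so \<eta> i is the parameter of iteration i
    + 1 of the algorithm.\<close>
  define \<eta> where "\<eta> i = \<epsilon> * d powr (- real i)" for i
  have \<eta>: "0 < \<eta> i" "log d (\<eta> i) = log d \<epsilon> - real i" for i
    using \<epsilon> d by (simp_all add: \<eta>_def log_mult)
  have scale: "c_of n m \<alpha> \<epsilon> * (d powr (- ((real n + real m) / real m))) ^ i = c_of n m \<alpha> (\<eta> i)" for i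
    using c_of_scale[OF \<epsilon> d(2) assms(2)] by (simp add: \<eta>_def)
  let ?q = "\<lambda>i. illl_tuple lll n m A (c_of n m \<alpha> (\<eta> i))"
  note bounds = illl_tuple_bounds[OF assms(3,11,4) \<eta>(1) assms(1,2), folded assms(6), unfolded em]
  \<comment> \<open>Serves twice: at i = k it is the required size bound, and for i < k it keeps the
    loop from stopping early.\<close>
  have qQ: "real_of_int (max_abs (?q i)) \<le> Q" if "i \<le> k" for i
  proof -
    have "lt \<le> log d (\<eta> i)" using k(1) that \<eta>(2)[of i] by simp
    then have "e / real m * log d \<beta> - real n / real m * log d (\<eta> i) \<le> log d Q"
      using n m by (simp add: lt_def field_simps)
    then have "log d (\<beta> powr (e / real m) * \<eta> i powr (- (real n / real m))) \<le> log d Q"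
      using \<eta>(1)[of i] \<beta> by (simp add: log_mult log_powr)
    then have "\<beta> powr (e / real m) * \<eta> i powr (- (real n / real m)) \<le> Q"
      using log_le_cancel_iff[OF d(1) _ Q] \<eta>(1)[of i] \<beta> by simp
    then show ?thesis
      using max_abs_le_iff[OF bounds(1) assms(2)] bounds(3) by (meson order_trans)
  qed
  \<comment> \<open>\<open>lt\<close> decreases in Q, so it is at least its value at Q = qmax. This
    puts k + 1 below the argument of the ceiling in \<open>illl_bound\<close>, and k, counted from
    0, falls under the cap.\<close>
  have "lt \<ge> - (real m / real n) * log d qmax + e / real n * log d \<beta>"
    unfolding lt_def using hi Q d(1) n m by (simp add: divide_right_mono mult_left_mono)
  then have "real k + 1 \<le> real m / real n * log d qmax + 1 + log d \<epsilon> - e / real n * log d \<beta>"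
    using k(1) by simp
  then have "k < nat (illl_bound n m \<epsilon> d \<alpha> qmax)"
    unfolding illl_bound_def en assms(6)[symmetric] by linarith
  then have mem: "?q k \<in> set (illl lll n m A \<epsilon> d \<alpha> qmax)"
    unfolding illl_def using qQ hi
    by (intro illl_tuple_in_loop[where c = "c_of n m \<alpha> \<epsilon>" and n = n and m = m and d = d, unfolded scale])
       (auto intro: order_trans[OF _ hi])
  \<comment> \<open>By maximality of k, dividing \<eta> k by d once more would fall below
    \<open>d powr lt\<close>; the right-hand side is the logarithm of d times
    \<open>d powr lt\<close>.\<close>
  have "log d (\<eta> k) \<le> log d (d * Q powr (- (real m / real n)) * \<beta> powr (e / real n))"
    using k(2) \<eta>(2)[of k] d Q \<beta> by (simp add: log_mult log_powr lt_def)
  then have "\<eta> k \<le> d * Q powr (- (real m / real n)) * \<beta> powr (e / real n)"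
    using log_le_cancel_iff[OF d(1) \<eta>(1)[of k]] d Q \<beta> by simp
  then have "Max ((\<lambda>i. dist_nearest_int (\<Sum>j<m. real_of_int (?q k $ j) * A $$ (i, j))) ` {..<n})
      \<le> d * Q powr (- (real m / real n)) * \<beta> powr (e / real n)"
    using bounds(2)[of _ k] assms(1) by (subst Max_le_iff) (auto simp: lessThan_empty_iff intro: order_trans)
  moreover have "Max ((\<lambda>j. \<bar>?q k $ j\<bar>) ` {..<m}) = max_abs (?q k)"
    using bounds(1)[of k] by (simp add: max_abs_def)
  ultimately show "\<exists>q \<in> set (illl lll n m A \<epsilon> d \<alpha> qmax).
        q \<in> carrier_vec m \<and>
        real_of_int (Max ((\<lambda>j. \<bar>q $ j\<bar>) ` {..<m})) \<le> Q \<and>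
        Max ((\<lambda>i. dist_nearest_int (\<Sum>j<m. real_of_int (q $ j) * A $$ (i, j))) ` {..<n})
          \<le> d * Q powr (- (real m / real n))
              * \<beta> powr ((real m + real n - 1) * (real m + real n) / (4 * real n))"
    unfolding en using mem bounds(1)[of k] qQ[of k] by (intro bexI[of _ "?q k"]) auto
qed

end
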